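(* Let $H$ be a complex Hilbert space, let $E$ be a POVM on $\Omega=\{0,1\}^{\mathbb N}$ with values in $B(H)$, and let $A_w$ ($w$ a finite word in $\{0,1\}$) be its splitting operators. Then $E$ is projection-valued if and only if $A_w^2=A_w$ for every finite word $w$.
   Context: $\Omega=\{0,1\}^{\mathbb N}$ carries its product Borel $\sigma$-algebra $\mathcal B(\Omega)$. For a finite word $w=w_1\cdots w_n$ in $\{0,1\}$, $[w]=\{x\in\Omega:x_1=w_1,\dots,x_n=w_n\}$; the empty word is $\varnothing$, and $[\varnothing]=\Omega$. A POVM on $\Omega$ with values in $B(H)$ is a map $E:\mathcal B(\Omega)\to B(H)_+$ that is countably additive in the weak operator topology and satisfies $E(\Omega)=I$. It is projection-valued if $E(B)$ is an orthogonal projection for every Borel set $B$. Put $E_w=E([w])$ and $H_w=\overline{\operatorname{ran}}(E_w^{1/2})$. The splitting operator $A_w$ is the unique positive contraction on $H_w$ (that is, $A_w\in B(H_w)$, $0\le A_w\le I_{H_w}$) such that $E_{w0}=E_w^{1/2}A_wE_w^{1/2}$, where $A_w$ is extended by zero on $H_w^\perp$; it also satisfies $E_{w1}=E_w^{1/2}(I_{H_w}-A_w)E_w^{1/2}$. *)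

theory Defs
  imports "HOL-Analysis.Analysis"
begin

section \<open>Complex Hilbert spaces\<close>

class complex_vector = real_vector +
  fixes scaleC :: "complex \<Rightarrow> 'a \<Rightarrow> 'a"  (infixr "*\<^sub>C" 75)
  assumes scaleC_add_right: "c *\<^sub>C (x + y) = c *\<^sub>C x + c *\<^sub>C y"
    and scaleC_add_left: "(c + d) *\<^sub>C x = c *\<^sub>C x + d *\<^sub>C x"
    and scaleC_scaleC: "c *\<^sub>C d *\<^sub>C x = (c * d) *\<^sub>C x"
    and scaleC_one: "1 *\<^sub>C x = x"
    and scaleR_scaleC: "r *\<^sub>R x = complex_of_real r *\<^sub>C x"

text \<open>The complex inner product is linear in its second argument. Its real part is the inner
  product of \<^class>\<open>real_inner\<close>; hence \<open>cinner x x\<close> is real, positive definite and equal to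
  \<open>(norm x)\<^sup>2\<close>, and norm and topology are those of the library.\<close>

class complex_inner = complex_vector + real_inner +
  fixes cinner :: "'a \<Rightarrow> 'a \<Rightarrow> complex"
  assumes cinner_commute: "cinner x y = cnj (cinner y x)"
    and cinner_add_right: "cinner x (y + z) = cinner x y + cinner x z"
    and cinner_scaleC_right: "cinner x (c *\<^sub>C y) = c * cinner x y"
    and inner_eq_Re_cinner: "inner x y = Re (cinner x y)"

class chilbert_space = complex_inner + complete_space

instantiation complex :: chilbert_space
begin

definition "c *\<^sub>C (x::complex) = c * x"

definition "cinner (x::complex) y = cnj x * y"

instance
  by standard
    (auto simp: scaleC_complex_def cinner_complex_def inner_complex_def scaleR_conv_of_real
      algebra_simps)

end

section \<open>Bounded operators\<close>

definition bounded_clinear :: "('a::complex_inner \<Rightarrow> 'a) \<Rightarrow> bool" where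
  "bounded_clinear T \<longleftrightarrow> bounded_linear T \<and> (\<forall>c x. T (c *\<^sub>C x) = c *\<^sub>C T x)"

definition nonneg_on :: "'a::complex_inner set \<Rightarrow> ('a \<Rightarrow> 'a) \<Rightarrow> bool" where
  "nonneg_on M T \<longleftrightarrow> (\<forall>x\<in>M. cinner x (T x) \<in> \<real>\<^sub>\<ge>\<^sub>0)"

definition positive_op :: "('a::complex_inner \<Rightarrow> 'a) \<Rightarrow> bool" where
  "positive_op T \<longleftrightarrow> bounded_clinear T \<and> nonneg_on UNIV T"

definition orthogonal_projection :: "('a::complex_inner \<Rightarrow> 'a) \<Rightarrow> bool" where
  "orthogonal_projection P \<longleftrightarrow>
     bounded_clinear P \<and> P \<circ> P = P \<and> (\<forall>x y. cinner (P x) y = cinner x (P y))"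

definition op_sqrt :: "('a::chilbert_space \<Rightarrow> 'a) \<Rightarrow> 'a \<Rightarrow> 'a" where
  "op_sqrt T = (THE S. positive_op S \<and> S \<circ> S = T)"

definition ortho_compl :: "'a::complex_inner set \<Rightarrow> 'a set" where
  "ortho_compl M = {y. \<forall>x\<in>M. cinner x y = 0}"

section \<open>POVMs on the Cantor space\<close>

text \<open>The space \<open>{0,1}\<^sup>\<nat>\<close> is the type \<^typ>\<open>nat \<Rightarrow> bool\<close> (\<^term>\<open>False\<close> for 0, \<^term>\<open>True\<close> for 1,
  coordinates numbered from 0); \<^term>\<open>borel\<close> on it refers to the product of the discrete
  topologies. Values of a POVM on sets that are not Borel are irrelevant.\<close>

definition povm :: "((nat \<Rightarrow> bool) set \<Rightarrow> 'a::chilbert_space \<Rightarrow> 'a) \<Rightarrow> bool" where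
  "povm E \<longleftrightarrow>
     (\<forall>B\<in>sets borel. positive_op (E B)) \<and>
     (\<forall>B :: nat \<Rightarrow> (nat \<Rightarrow> bool) set. range B \<subseteq> sets borel \<longrightarrow> disjoint_family B \<longrightarrow>
        (\<forall>x y. (\<lambda>n. cinner x (E (B n) y)) sums cinner x (E (\<Union>n. B n) y))) \<and>
     E UNIV = id"

definition projection_valued :: "((nat \<Rightarrow> bool) set \<Rightarrow> 'a::chilbert_space \<Rightarrow> 'a) \<Rightarrow> bool" where
  "projection_valued E \<longleftrightarrow> (\<forall>B\<in>sets borel. orthogonal_projection (E B))"

definition cylinder :: "bool list \<Rightarrow> (nat \<Rightarrow> bool) set" where
  "cylinder w = {x. \<forall>i<length w. x i = w ! i}"

definition sqrt_space ::
    "((nat \<Rightarrow> bool) set \<Rightarrow> 'a::chilbert_space \<Rightarrow> 'a) \<Rightarrow> bool list \<Rightarrow> 'a set" where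
  "sqrt_space E w = closure (range (op_sqrt (E (cylinder w))))"

text \<open>An operator on \<open>H\<^sub>w =\<close> \<^term>\<open>sqrt_space E w\<close> is represented by its extension by zero on the
  orthogonal complement, that is, by an operator on the whole space with range in \<open>H\<^sub>w\<close> that
  vanishes on \<open>H\<^sub>w\<^sup>\<bottom>\<close>. With this convention the operator is unique on the whole space, and its
  square is the extension by zero of the square on \<open>H\<^sub>w\<close>.\<close>

definition is_splitting_op ::
    "((nat \<Rightarrow> bool) set \<Rightarrow> 'a::chilbert_space \<Rightarrow> 'a) \<Rightarrow> bool list \<Rightarrow> ('a \<Rightarrow> 'a) \<Rightarrow> bool" where
  "is_splitting_op E w A \<longleftrightarrow>
     bounded_clinear A \<and>
     range A \<subseteq> sqrt_space E w \<and>
     (\<forall>x\<in>ortho_compl (sqrt_space E w). A x = 0) \<and>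
     nonneg_on (sqrt_space E w) A \<and>
     nonneg_on (sqrt_space E w) (\<lambda>x. x - A x) \<and>
     E (cylinder (w @ [False])) = op_sqrt (E (cylinder w)) \<circ> A \<circ> op_sqrt (E (cylinder w))"

definition splitting_op ::
    "((nat \<Rightarrow> bool) set \<Rightarrow> 'a::chilbert_space \<Rightarrow> 'a) \<Rightarrow> bool list \<Rightarrow> 'a \<Rightarrow> 'a" where
  "splitting_op E w = (THE A. is_splitting_op E w A)"

end

theory Submission
  imports Defs
begin

text \<open>
  The argument avoids square roots of general positive operators. If \<open>E\<^sub>w\<close> is an orthogonal
  projection, then \<open>E\<^sub>w\<^bsup>1/2\<^esup> = E\<^sub>w\<close>, and since \<open>0 \<le> E\<^bsub>w0\<^esub> \<le> E\<^sub>w\<close> the operator \<open>E\<^bsub>w0\<^esub>\<close> is absorbed by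
  \<open>E\<^sub>w\<close> on both sides; hence \<open>E\<^bsub>w0\<^esub>\<close> itself is the splitting operator \<open>A\<^sub>w\<close>
  (\<open>splitting_op_eq_left_child\<close>). If \<open>E\<close> is projection-valued, this makes every \<open>A\<^sub>w\<close> idempotent.

  Conversely, suppose that all \<open>A\<^sub>w\<close> are idempotent. The root operator \<open>E(\<Omega>) = I\<close> is a projection,
  and if \<open>E\<^sub>w\<close> is a projection, so are \<open>E\<^bsub>w0\<^esub> = A\<^sub>w\<close> and \<open>E\<^bsub>w1\<^esub> = E\<^sub>w - E\<^bsub>w0\<^esub>\<close>. By induction all \<open>E\<^sub>w\<close>
  are projections. When \<open>E(C)\<close> is a projection, \<open>E(B) E(C) = E(B \<inter> C)\<close> for every Borel set \<open>B\<close>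
  (\<open>povm_Int\<close>); it follows that the Borel sets on which \<open>E\<close> is a projection form a
  \<open>\<sigma>\<close>-algebra (\<open>sigma_algebra_projection_sets\<close>). It contains the cylinders, hence every Borel set.

  Vectors are separated by the real inner product, so most computations use that one; the complex
  structure matters for the self-adjointness of positive operators (\<open>positive_op_adjoint\<close>).
\<close>

section \<open>Positive operators and projections\<close>

lemma positive_op_linear: "positive_op T \<Longrightarrow> linear T"
  by (simp add: positive_op_def bounded_clinear_def bounded_linear.linear)

lemma cinner_nonneg_iff:
  "cinner x y \<in> \<real>\<^sub>\<ge>\<^sub>0 \<longleftrightarrow> Im (cinner x y) = 0 \<and> 0 \<le> inner x y"
  by (auto simp: complex_nonneg_Reals_iff inner_eq_Re_cinner)

lemma positive_op_inner_nonneg: "positive_op T \<Longrightarrow> 0 \<le> inner x (T x)"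
  by (simp add: positive_op_def nonneg_on_def cinner_nonneg_iff)

lemma cinner_add_left: "cinner (x + y) z = cinner x z + cinner y z"
  by (metis cinner_add_right cinner_commute complex_cnj_add)

lemma cinner_zero_right: "cinner x 0 = 0"
  by (metis add_cancel_right_right cinner_add_right)

lemma cinner_scaleC_left: "cinner (c *\<^sub>C x) y = cnj c * cinner x y"
  by (metis cinner_commute cinner_scaleC_right complex_cnj_mult)

text \<open>Over the complex numbers, an operator with real quadratic form is self-adjoint: polarise with
  \<open>x + y\<close> for the imaginary parts and with \<open>x + \<i>y\<close> for the real parts.\<close>

lemma positive_op_adjoint:
  assumes "positive_op T"
  shows "cinner (T x) y = cinner x (T y)"
proof -
  have add: "T (a + b) = T a + T b" for a b
    using positive_op_linear[OF assms] by (rule linear_add)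
  have scale: "T (c *\<^sub>C a) = c *\<^sub>C T a" for c a
    using assms by (simp add: positive_op_def bounded_clinear_def)
  have real: "Im (cinner a (T a)) = 0" for a
    using assms by (simp add: positive_op_def nonneg_on_def cinner_nonneg_iff)
  have 1: "Im (cinner x (T y)) + Im (cinner y (T x)) = 0"
    using real[of "x + y"] real[of x] real[of y]
    by (simp add: add cinner_add_left cinner_add_right)
  have 2: "Re (cinner x (T y)) = Re (cinner y (T x))"
    using real[of "x + \<i> *\<^sub>C y"] real[of x] real[of y]
    by (simp add: add scale cinner_add_left cinner_add_right cinner_scaleC_left
        cinner_scaleC_right)
  have "cinner (T x) y = cnj (cinner y (T x))"
    by (rule cinner_commute)
  also have "\<dots> = cinner x (T y)"
    using 1 2 by (simp add: complex_eq_iff)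
  finally show ?thesis .
qed

lemma positive_op_symmetric: "positive_op T \<Longrightarrow> inner (T x) y = inner x (T y)"
  by (simp add: inner_eq_Re_cinner positive_op_adjoint)

lemma orthogonal_projection_iff_idem:
  "positive_op P \<Longrightarrow> orthogonal_projection P \<longleftrightarrow> (\<forall>x. P (P x) = P x)"
  by (auto simp: orthogonal_projection_def positive_op_adjoint positive_op_def fun_eq_iff)

text \<open>If \<open>z\<close> is a zero of the quadratic form of a positive operator \<open>T\<close>, then \<open>T z = 0\<close>: otherwise
  the form would be negative at \<open>z + t T z\<close> for small negative \<open>t\<close>.\<close>

lemma positive_op_eq_0:
  assumes T: "positive_op T" and z: "inner z (T z) = 0"
  shows "T z = 0"
proof -
  define w where "w = T z"
  define a where "a = inner w w"
  define c where "c = inner w (T w)"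
  have c: "0 \<le> c"
    unfolding c_def by (rule positive_op_inner_nonneg[OF T])
  define t where "t = - a / (c + 1)"
  have "0 \<le> inner (z + t *\<^sub>R w) (T (z + t *\<^sub>R w))"
    by (rule positive_op_inner_nonneg[OF T])
  also have "\<dots> = 2 * t * a + t\<^sup>2 * c"
    using z positive_op_symmetric[OF T, of z w]
    by (simp add: linear_add[OF positive_op_linear[OF T]] linear_scale[OF positive_op_linear[OF T]]
        inner_add_left inner_add_right a_def c_def w_def power2_eq_square algebra_simps
        inner_commute)
  also have "\<dots> = - (a\<^sup>2 * (c + 2)) / (c + 1)\<^sup>2"
    using c by (simp add: t_def power2_eq_square divide_simps) (simp add: algebra_simps)
  finally have "a\<^sup>2 * (c + 2) \<le> 0"
    using c by (simp add: divide_simps split: if_splits)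
  with c have "a\<^sup>2 \<le> 0"
    by (simp add: mult_le_0_iff)
  then show ?thesis
    by (simp add: a_def w_def)
qed

text \<open>An operator \<open>Q\<close> with \<open>0 \<le> Q \<le> P\<close>, where \<open>P\<close> is a projection, lives on the range of \<open>P\<close>.\<close>

lemma positive_op_le_projection_right:
  assumes Q: "positive_op Q" and P: "positive_op P" and idem: "\<And>x. P (P x) = P x"
    and le: "\<And>x. inner x (Q x) \<le> inner x (P x)"
  shows "Q (P x) = Q x"
proof -
  define z where "z = x - P x"
  have "P z = 0"
    by (simp add: z_def linear_diff[OF positive_op_linear[OF P]] idem)
  then have "inner z (Q z) = 0"
    using le[of z] positive_op_inner_nonneg[OF Q, of z] by simp
  then have "Q z = 0"
    by (rule positive_op_eq_0[OF Q])
  then show ?thesis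
    by (simp add: z_def linear_diff[OF positive_op_linear[OF Q]])
qed

lemma positive_op_le_projection_left:
  assumes Q: "positive_op Q" and P: "positive_op P" and idem: "\<And>x. P (P x) = P x"
    and le: "\<And>x. inner x (Q x) \<le> inner x (P x)"
  shows "P (Q x) = Q x"
proof (rule vector_eq_ldot[THEN iffD1], rule allI)
  fix y
  show "inner y (P (Q x)) = inner y (Q x)"
    using positive_op_le_projection_right[OF assms, of y]
      positive_op_symmetric[OF P, of y "Q x"] positive_op_symmetric[OF Q, of "P y" x]
      positive_op_symmetric[OF Q, of y x]
    by simp
qed

lemma op_sqrt_projection:
  assumes P: "positive_op P" and idem: "\<And>x. P (P x) = P x"
  shows "op_sqrt P = P"
  unfolding op_sqrt_def
proof (rule the_equality)
  show "positive_op P \<and> P \<circ> P = P"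
    using P idem by auto
next
  fix S
  assume "positive_op S \<and> S \<circ> S = P"
  then have S: "positive_op S" and SS: "S (S x) = P x" for x
    by (auto simp: fun_eq_iff)
  note diff = linear_diff[OF positive_op_linear[OF S]]
  have SP: "S (P x) = S x" for x
  proof -
    define z where "z = x - P x"
    have "P z = 0"
      by (simp add: z_def linear_diff[OF positive_op_linear[OF P]] idem)
    then have "inner (S z) (S z) = 0"
      by (simp add: positive_op_symmetric[OF S] SS)
    then show ?thesis
      by (simp add: z_def diff)
  qed
  show "S = P"
  proof
    fix x
    \<comment> \<open>On the range of \<open>P\<close> the equation reads \<open>(S + 1)(S - 1) = 0\<close>, and \<open>S + 1\<close> is injective.\<close>
    define y where "y = S x - P x"
    have "S y = - y"
      by (simp add: y_def diff SS SP)
    then have "inner y y \<le> 0"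
      using positive_op_inner_nonneg[OF S, of y] by simp
    then have "y = 0"
      by (metis antisym inner_eq_zero_iff inner_ge_zero)
    then show "S x = P x"
      by (simp add: y_def)
  qed
qed

lemma closure_range_projection:
  assumes P: "positive_op P" and idem: "\<And>x. P (P x) = P x"
  shows "closure (range P) = {x. P x = x}"
proof -
  have "continuous_on UNIV P"
    using P by (simp add: positive_op_def bounded_clinear_def linear_continuous_on)
  then have "closed {x. P x = x}"
    by (intro closed_Collect_eq continuous_intros)
  moreover have "range P = {x. P x = x}"
    using idem by auto (metis rangeI)
  ultimately show ?thesis
    by simp
qed

section \<open>Additivity of operator-valued measures\<close>

lemma povm_positive: "povm E \<Longrightarrow> B \<in> sets borel \<Longrightarrow> positive_op (E B)"
  by (simp add: povm_def)

lemma povm_UNIV: "povm E \<Longrightarrow> E UNIV x = x"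
  by (simp add: povm_def)

lemma povm_sums:
  assumes "povm E" "range B \<subseteq> sets borel" "disjoint_family B"
  shows "(\<lambda>n. inner x (E (B n) y)) sums inner x (E (\<Union>n. B n) y)"
proof -
  have "(\<lambda>n. cinner x (E (B n) y)) sums cinner x (E (\<Union>n. B n) y)"
    using assms by (simp add: povm_def)
  then show ?thesis
    unfolding inner_eq_Re_cinner by (rule sums_Re)
qed

lemma povm_empty:
  assumes "povm E"
  shows "E {} x = 0"
proof (rule vector_eq_ldot[THEN iffD1], rule allI)
  fix y
  have "(\<lambda>n::nat. inner y (E {} x)) sums inner y (E (\<Union>n::nat. {}) x)"
    using assms by (rule povm_sums) (auto simp: disjoint_family_on_def)
  then show "inner y (E {} x) = inner y 0"
    using sums_summable summable_const_iff by fastforce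
qed

lemma povm_Un:
  assumes E: "povm E" and B: "B \<in> sets borel" and C: "C \<in> sets borel" and disj: "B \<inter> C = {}"
  shows "E (B \<union> C) x = E B x + E C x"
proof (rule vector_eq_ldot[THEN iffD1], rule allI)
  fix y
  have "range (binaryset B C) \<subseteq> sets borel" "disjoint_family (binaryset B C)"
    using B C disj by (auto simp: binaryset_def disjoint_family_on_def)
  then have "(\<lambda>n. inner y (E (binaryset B C n) x)) sums inner y (E (\<Union>n. binaryset B C n) x)"
    by (rule povm_sums[OF E])
  then have "(\<lambda>n. inner y (E (binaryset B C n) x)) sums inner y (E (B \<union> C) x)"
    by (simp add: UN_binaryset_eq)
  moreover have "(\<lambda>n. inner y (E (binaryset B C n) x)) sums (inner y (E B x) + inner y (E C x))"
    by (rule binaryset_sums) (simp add: povm_empty[OF E])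
  ultimately show "inner y (E (B \<union> C) x) = inner y (E B x + E C x)"
    by (simp add: inner_add_right sums_unique2)
qed

lemma povm_Compl:
  assumes "povm E" and "B \<in> sets borel"
  shows "E (- B) x = x - E B x"
  using povm_Un[OF assms, of "- B" x] povm_UNIV[OF assms(1), of x] assms(2)
  by (simp add: Compl_partition borel_comp algebra_simps)

lemma povm_mono:
  assumes E: "povm E" and B: "B \<in> sets borel" and C: "C \<in> sets borel" and "B \<subseteq> C"
  shows "inner x (E B x) \<le> inner x (E C x)"
proof -
  have "E C x = E B x + E (C - B) x"
    using povm_Un[OF E B, of "C - B" x] B C \<open>B \<subseteq> C\<close> by (simp add: Un_absorb1)
  moreover have "0 \<le> inner x (E (C - B) x)"
    using E B C by (intro positive_op_inner_nonneg povm_positive) auto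
  ultimately show ?thesis
    by (simp add: inner_add_right)
qed

section \<open>The sets on which the measure is a projection\<close>

text \<open>The Borel sets \<open>B\<close> with \<open>E(B)\<^sup>2 = E(B)\<close>. For a POVM the operator \<open>E(B)\<close> is self-adjoint, so
  idempotence is all that is needed for it to be an orthogonal projection.\<close>

definition projection_sets ::
    "((nat \<Rightarrow> bool) set \<Rightarrow> 'a::chilbert_space \<Rightarrow> 'a) \<Rightarrow> (nat \<Rightarrow> bool) set set" where
  "projection_sets E = {B \<in> sets borel. \<forall>x. E B (E B x) = E B x}"

lemma projection_setsD:
  assumes "B \<in> projection_sets E"
  shows "B \<in> sets borel" "E B (E B x) = E B x"
  using assms by (auto simp: projection_sets_def)

lemma projection_valued_iff_projection_sets:
  assumes "povm E"
  shows "projection_valued E \<longleftrightarrow> sets borel \<subseteq> projection_sets E"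
  using orthogonal_projection_iff_idem[OF povm_positive[OF assms]]
  by (auto simp: projection_valued_def projection_sets_def)

lemma UNIV_projection_sets: "povm E \<Longrightarrow> UNIV \<in> projection_sets E"
  by (simp add: projection_sets_def povm_UNIV)

lemma povm_subset:
  assumes E: "povm E" and C: "C \<in> projection_sets E" and B: "B \<in> sets borel" and "B \<subseteq> C"
  shows "E B (E C x) = E B x" and "E C (E B x) = E B x"
proof -
  note asm = povm_positive[OF E B] povm_positive[OF E projection_setsD(1)[OF C]]
    projection_setsD(2)[OF C] povm_mono[OF E B projection_setsD(1)[OF C] \<open>B \<subseteq> C\<close>]
  show "E B (E C x) = E B x"
    using asm by (rule positive_op_le_projection_right)
  show "E C (E B x) = E B x"
    using asm by (rule positive_op_le_projection_left)
qed

lemma projection_sets_Compl: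
  assumes E: "povm E" and B: "B \<in> projection_sets E"
  shows "- B \<in> projection_sets E"
proof -
  note borel = projection_setsD(1)[OF B]
  show ?thesis
    using borel
    by (simp add: projection_sets_def borel_comp povm_Compl[OF E borel] projection_setsD(2)[OF B]
        linear_diff[OF positive_op_linear[OF povm_positive[OF E borel]]])
qed

text \<open>Split \<open>B\<close> along \<open>C\<close>: the part outside \<open>C\<close> is absorbed by the projection \<open>I - E(C)\<close>.\<close>

lemma povm_Int:
  assumes E: "povm E" and C: "C \<in> projection_sets E" and B: "B \<in> sets borel"
  shows "E B (E C x) = E (B \<inter> C) x"
proof -
  note borel = projection_setsD(1)[OF C]
  have BC: "B \<inter> C \<in> sets borel" "B - C \<in> sets borel"
    using B borel by auto
  have "E (B - C) (E (- C) x) = E (B - C) x"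
    using povm_subset(1)[OF E projection_sets_Compl[OF E C] BC(2)] by auto
  then have "E (B - C) (E C x) = 0"
    by (simp add: povm_Compl[OF E borel]
        linear_diff[OF positive_op_linear[OF povm_positive[OF E BC(2)]]])
  moreover have "E (B \<inter> C) (E C x) = E (B \<inter> C) x"
    using povm_subset(1)[OF E C BC(1)] by auto
  moreover have "E B (E C x) = E (B \<inter> C) (E C x) + E (B - C) (E C x)"
    using povm_Un[OF E BC, of "E C x"] by (simp add: Int_Diff_disjoint Int_Diff_Un)
  ultimately show ?thesis
    by simp
qed

lemma projection_sets_Int:
  assumes E: "povm E" and B: "B \<in> projection_sets E" and C: "C \<in> projection_sets E"
  shows "B \<inter> C \<in> projection_sets E"
proof -
  note borel = projection_setsD(1)[OF B] projection_setsD(1)[OF C]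
  have "E (B \<inter> C) (E (B \<inter> C) x) = E (B \<inter> C) x" for x
    using povm_Int[OF E C borel(1)] povm_Int[OF E B borel(2)] projection_setsD(2)[OF B]
      projection_setsD(2)[OF C] by (metis inf_commute)
  then show ?thesis
    using borel by (simp add: projection_sets_def)
qed

lemma projection_sets_disjoint_UN:
  fixes B :: "nat \<Rightarrow> (nat \<Rightarrow> bool) set"
  assumes E: "povm E" and B: "range B \<subseteq> projection_sets E" and disj: "disjoint_family B"
  shows "(\<Union>n. B n) \<in> projection_sets E"
proof -
  define U where "U = (\<Union>n. B n)"
  have B': "B n \<in> projection_sets E" for n
    using B by auto
  have borel: "range B \<subseteq> sets borel"
    using projection_setsD(1)[OF B'] by auto
  then have U: "U \<in> sets borel"
    unfolding U_def by auto
  have "E U (E U x) = E U x" for x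
  proof (rule vector_eq_ldot[THEN iffD1], rule allI)
    fix y
    have absorb: "inner y (E (B n) (E U x)) = inner y (E (B n) x)" for n
    proof -
      \<comment> \<open>Only \<open>E(B\<^sub>n)\<close> is known to be a projection, so the product \<open>E(B\<^sub>n) E(U)\<close> is computed through
        its adjoint \<open>E(U) E(B\<^sub>n) = E(U \<inter> B\<^sub>n) = E(B\<^sub>n)\<close>.\<close>
      have "U \<inter> B n = B n"
        by (auto simp: U_def)
      then have "E U (E (B n) y) = E (B n) y"
        using povm_Int[OF E B' U] by metis
      then show ?thesis
        using positive_op_symmetric[OF povm_positive[OF E U], of "E (B n) y" x]
          positive_op_symmetric[OF povm_positive[OF E projection_setsD(1)[OF B']], of n y]
        by metis
    qed
    have "(\<lambda>n. inner y (E (B n) (E U x))) sums inner y (E U (E U x))"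
      unfolding U_def by (rule povm_sums[OF E borel disj])
    moreover have "(\<lambda>n. inner y (E (B n) x)) sums inner y (E U x)"
      unfolding U_def by (rule povm_sums[OF E borel disj])
    ultimately show "inner y (E U (E U x)) = inner y (E U x)"
      unfolding absorb by (rule sums_unique2)
  qed
  with U show ?thesis
    by (simp add: projection_sets_def U_def)
qed

lemma sigma_algebra_projection_sets:
  assumes "povm E"
  shows "sigma_algebra UNIV (projection_sets E)"
proof -
  have "{} \<in> projection_sets E"
    using projection_sets_Compl[OF assms UNIV_projection_sets[OF assms]] by simp
  then show ?thesis
    unfolding sigma_algebra_disjoint_iff algebra_iff_Int
    using projection_sets_Compl[OF assms] projection_sets_Int[OF assms]
      projection_sets_disjoint_UN[OF assms]
    by (auto simp: Compl_eq_Diff_UNIV)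
qed

section \<open>Cylinders generate the Borel sets\<close>

lemma cylinder_Nil: "cylinder [] = UNIV"
  by (simp add: cylinder_def)

lemma cylinder_borel: "cylinder w \<in> sets borel"
proof -
  have "cylinder w = (\<Pi>\<^sub>E i\<in>UNIV. if i < length w then {w ! i} else UNIV)"
    by (auto simp: cylinder_def PiE_def Pi_def split: if_splits)
  moreover have "open (\<Pi>\<^sub>E i\<in>UNIV. if i < length w then {w ! i} else UNIV)"
  proof (rule open_PiE)
    show "open (if i < length w then {w ! i} else UNIV)" for i
      by (simp add: open_discrete)
    show "finite {i. (if i < length w then {w ! i} else UNIV) \<noteq> UNIV}"
      by (rule finite_subset[of _ "{..<length w}"]) auto
  qed
  ultimately show ?thesis
    by simp
qed

lemma cylinder_append: "cylinder (w @ [b]) = {x \<in> cylinder w. x (length w) = b}"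
  by (auto simp: cylinder_def nth_append less_Suc_eq)

lemma cylinder_children:
  "cylinder w = cylinder (w @ [False]) \<union> cylinder (w @ [True])"
  "cylinder (w @ [False]) \<inter> cylinder (w @ [True]) = {}"
  by (auto simp: cylinder_append)

lemma cylinder_subset_open:
  assumes "open U" and "x \<in> U"
  obtains w where "x \<in> cylinder w" "cylinder w \<subseteq> U"
proof -
  have "openin (product_topology (\<lambda>i. euclidean) UNIV) U"
    using \<open>open U\<close> by (simp add: open_fun_def)
  from product_topology_open_contains_basis[OF this \<open>x \<in> U\<close>] obtain X where
    X: "x \<in> (\<Pi>\<^sub>E i\<in>UNIV. X i)" "finite {i. X i \<noteq> UNIV}" "(\<Pi>\<^sub>E i\<in>UNIV. X i) \<subseteq> U"
    by auto
  obtain n where n: "\<And>i. X i \<noteq> UNIV \<Longrightarrow> i < n"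
    using X(2) finite_nat_set_iff_bounded by auto
  define w where "w = map x [0..<n]"
  have "cylinder w \<subseteq> (\<Pi>\<^sub>E i\<in>UNIV. X i)"
  proof
    fix y
    assume y: "y \<in> cylinder w"
    have "y i \<in> X i" for i
    proof (cases "i < n")
      case True
      then have "y i = x i"
        using y by (simp add: cylinder_def w_def)
      then show ?thesis
        using X(1) by auto
    next
      case False
      then show ?thesis
        using n by blast
    qed
    then show "y \<in> (\<Pi>\<^sub>E i\<in>UNIV. X i)"
      by auto
  qed
  then have "cylinder w \<subseteq> U"
    using X(3) by (rule subset_trans)
  moreover have "x \<in> cylinder w"
    by (simp add: cylinder_def w_def)
  ultimately show ?thesis
    by (intro that)
qed

lemma borel_subset_if_cylinders:
  assumes M: "sigma_algebra UNIV M" and cyl: "\<And>w. cylinder w \<in> M"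
  shows "sets borel \<subseteq> M"
proof -
  have "U \<in> M" if "open U" for U
  proof -
    have "U = (\<Union>w\<in>{w. cylinder w \<subseteq> U}. cylinder w)"
      using cylinder_subset_open[OF that] by blast
    also have "\<dots> \<in> M"
      using cyl by (intro sigma_algebra.countable_UN'[OF M]) auto
    finally show ?thesis .
  qed
  then show ?thesis
    unfolding sets_borel by (intro sigma_algebra.sigma_sets_subset[OF M]) auto
qed

section \<open>The splitting operators\<close>

text \<open>With \<open>P = E\<^sub>w\<close> a projection and \<open>Q = E\<^bsub>w0\<^esub>\<close>, the defining equation of the splitting operator
  reads \<open>Q = P A P\<close>. The solution \<open>A = Q\<close> is admissible since \<open>0 \<le> Q \<le> P\<close>, and it is the only
  one since an operator that lives on the range of \<open>P\<close> satisfies \<open>P A P = A\<close>.\<close>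

lemma splitting_op_eq_left_child:
  assumes E: "povm E" and w: "cylinder w \<in> projection_sets E"
  shows "splitting_op E w = E (cylinder (w @ [False]))"
proof -
  define P where "P = E (cylinder w)"
  define Q where "Q = E (cylinder (w @ [False]))"
  have P: "positive_op P" and Q: "positive_op Q"
    by (simp_all add: P_def Q_def povm_positive[OF E] cylinder_borel)
  have idem: "P (P x) = P x" for x
    unfolding P_def by (rule projection_setsD(2)[OF w])
  have QP: "Q (P x) = Q x" and PQ: "P (Q x) = Q x" for x
    unfolding P_def Q_def using cylinder_children(1)[of w]
    by (intro povm_subset[OF E w cylinder_borel]; blast)+
  have sqrt: "op_sqrt (E (cylinder w)) = P"
    unfolding P_def[symmetric] by (rule op_sqrt_projection[OF P idem])
  have space: "sqrt_space E w = {x. P x = x}"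
    by (simp add: sqrt_space_def sqrt closure_range_projection[OF P idem])
  have compl: "ortho_compl {x. P x = x} = {x. P x = 0}"
  proof -
    have "x \<in> ortho_compl {x. P x = x}" if "P x = 0" for x
    proof -
      have "cinner y x = 0" if "P y = y" for y
        using positive_op_adjoint[OF P, of y x] \<open>P x = 0\<close> that
        by (simp add: cinner_zero_right)
      then show ?thesis
        by (simp add: ortho_compl_def)
    qed
    moreover have "P x = 0" if "x \<in> ortho_compl {x. P x = x}" for x
    proof -
      have "inner (P x) x = 0"
        using that by (simp add: ortho_compl_def idem inner_eq_Re_cinner)
      then show ?thesis
        by (simp add: inner_commute positive_op_eq_0[OF P])
    qed
    ultimately show ?thesis
      by blast
  qed
  have "is_splitting_op E w A \<longleftrightarrow> A = Q" for A
  proof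
    assume "is_splitting_op E w A"
    then have A: "linear A" "range A \<subseteq> {x. P x = x}" "\<And>x. P x = 0 \<Longrightarrow> A x = 0" "Q = P \<circ> A \<circ> P"
      by (auto simp: is_splitting_op_def space compl sqrt Q_def bounded_clinear_def
          bounded_linear.linear)
    show "A = Q"
    proof
      fix x
      have "A (x - P x) = 0"
        by (rule A(3)) (simp add: linear_diff[OF positive_op_linear[OF P]] idem)
      then have "A x = A (P x)"
        by (simp add: linear_diff[OF A(1)])
      moreover have "P (A (P x)) = A (P x)"
        using A(2) by blast
      ultimately show "A x = Q x"
        using A(4) by simp
    qed
  next
    assume "A = Q"
    have "Q = P \<circ> Q \<circ> P"
      by (auto simp: QP PQ)
    moreover have "nonneg_on {x. P x = x} (\<lambda>x. x - Q x)"
    proof -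
      \<comment> \<open>On the range of \<open>P\<close>, the operator \<open>I - Q\<close> agrees with the value of \<open>E\<close> on the other child.\<close>
      have "x - Q x = E (cylinder (w @ [True])) x" if "P x = x" for x
        using povm_Un[OF E cylinder_borel cylinder_borel cylinder_children(2), of w x] that
        by (simp add: P_def Q_def flip: cylinder_children(1)) (metis add_diff_cancel_left')
      moreover have "positive_op (E (cylinder (w @ [True])))"
        by (simp add: povm_positive[OF E] cylinder_borel)
      ultimately show ?thesis
        by (simp add: nonneg_on_def positive_op_def)
    qed
    ultimately show "is_splitting_op E w A"
      using Q PQ QP \<open>A = Q\<close>
      by (auto simp: is_splitting_op_def space compl sqrt positive_op_def nonneg_on_def
          simp flip: Q_def) (metis QP linear_0 positive_op_linear Q)
  qed
  then show ?thesis
    by (simp add: splitting_op_def Q_def)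
qed

lemma projection_sets_children:
  assumes E: "povm E" and w: "cylinder w \<in> projection_sets E"
    and idem: "splitting_op E w \<circ> splitting_op E w = splitting_op E w"
  shows "cylinder (w @ [b]) \<in> projection_sets E"
proof -
  have 0: "cylinder (w @ [False]) \<in> projection_sets E"
    using idem cylinder_borel
    by (simp add: projection_sets_def splitting_op_eq_left_child[OF E w] fun_eq_iff)
  \<comment> \<open>The other child is the relative complement of the first.\<close>
  have "cylinder (w @ [True]) = cylinder w \<inter> - cylinder (w @ [False])"
    by (auto simp: cylinder_append)
  then have "cylinder (w @ [True]) \<in> projection_sets E"
    using projection_sets_Int[OF E w projection_sets_Compl[OF E 0]] by simp
  with 0 show ?thesis
    by (cases b) auto
qed

theorem proposition2p4:
  fixes E :: "(nat \<Rightarrow> bool) set \<Rightarrow> 'a::chilbert_space \<Rightarrow> 'a"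
  assumes "povm E"
  shows "projection_valued E \<longleftrightarrow>
    (\<forall>w. splitting_op E w \<circ> splitting_op E w = splitting_op E w)"
proof
  assume "projection_valued E"
  then have cyl: "cylinder w \<in> projection_sets E" for w
    using cylinder_borel projection_valued_iff_projection_sets[OF assms] by auto
  show "\<forall>w. splitting_op E w \<circ> splitting_op E w = splitting_op E w"
    by (auto simp: splitting_op_eq_left_child[OF assms cyl] projection_setsD(2)[OF cyl])
next
  assume idem: "\<forall>w. splitting_op E w \<circ> splitting_op E w = splitting_op E w"
  have "cylinder w \<in> projection_sets E" for w
  proof (induction w rule: rev_induct)
    case Nil
    then show ?case
      by (simp add: cylinder_Nil UNIV_projection_sets[OF assms])
  next
    case (snoc b w)
    then show ?case
      using projection_sets_children[OF assms] idem by blast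
  qed
  then have "sets borel \<subseteq> projection_sets E"
    by (rule borel_subset_if_cylinders[OF sigma_algebra_projection_sets[OF assms]])
  then show "projection_valued E"
    by (simp add: projection_valued_iff_projection_sets[OF assms])
qed

end
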